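(* Let $H=(V_H,E_H,w_H)$ be a non-covering hypergraph, and let $\nu_2(H)$ be the second smallest eigenvalue of its normalized Laplacian $\mathcal{L}_H$. Then $$\frac{\nu_2(H)}{2}\ \le\ \hat\phi_h(H)\ \le\ \sqrt{(2-\nu_2(H))\,\nu_2(H)},$$ where $\hat\phi_h(H)$ is the diffusion conductance of $H$.
   Context: A hypergraph $H=(V_H,E_H,w_H)$ consists of a nonempty finite vertex set $V_H$ with $n$ elements, a finite set $E_H\subseteq 2^{V_H}$ of hyperedges, each of size at least $2$, and a weight function $w_H:E_H\to[0,\infty)$. Hyperedges may have different sizes. The degree of $u$ is $d_H(u)=\sum_{e\in E_H:\,u\in e}w_H(e)$; all degrees are assumed positive. $H$ is covering if every pair of distinct vertices is contained in at least one hyperedge, and non-covering otherwise. For $S\subseteq V_H$ let $\mathrm{vol}_H(S)=\sum_{v\in S}d_H(v)$ and $\partial_h(S)=\{e\in E_H: e\cap S\ne\emptyset,\ e\cap(V_H\setminus S)\neq\emptyset\}$. The diffusion conductance of $S$ with $\emptyset\subsetneq S\subsetneq V_H$ is $$\hat\phi_h(S)=\frac{\sum_{e\in\partial_h(S)}\frac{w_H(e)}{|e|-1}\,|e\cap S|\,|e\cap(V_H\setminus S)|}{\min(\mathrm{vol}_H(S),\mathrm{vol}_H(V_H\setminus S))},$$ and $\hat\phi_h(H)=\min_{\emptyset\subsetneq S\subsetneq V_H}\hat\phi_h(S)$. The adjacency matrix is $A_H[u,v]=\sum_{e\in E_H:\{u,v\}\subseteq e}\frac{w_H(e)}{|e|-1}$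 for $u\ne v$ and $A_H[u,u]=0$. $D_H$ is the diagonal matrix of degrees, $L_H=D_H-A_H$ is the Laplacian, and $\mathcal{L}_H=D_H^{-1/2}L_HD_H^{-1/2}$ is the normalized Laplacian, with eigenvalues $\nu_1(H)\le\nu_2(H)\le\dots\le\nu_n(H)$ counted with multiplicity. *)

theory Defs
  imports
    "HOL-Analysis.Analysis"
    "HOL-Computational_Algebra.Polynomial"
    "HOL-Library.Multiset"
begin

text \<open>The vertex set is the universe of a finite type \<open>'v\<close> (hence nonempty), so that matrices
  indexed by vertices have type \<open>real ^ 'v ^ 'v\<close> and \<open>n = CARD('v)\<close>. The weight function is total,
  but only its values on hyperedges are ever used.\<close>

record 'v hypergraph =
  hyperedges :: "'v set set"
  weight :: "'v set \<Rightarrow> real"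

definition degree_of :: "'v::finite hypergraph \<Rightarrow> 'v \<Rightarrow> real" where
  "degree_of H u = (\<Sum>e\<in>{e \<in> hyperedges H. u \<in> e}. weight H e)"

definition is_hypergraph :: "'v::finite hypergraph \<Rightarrow> bool" where
  "is_hypergraph H \<longleftrightarrow>
     (\<forall>e\<in>hyperedges H. 2 \<le> card e) \<and>
     (\<forall>e\<in>hyperedges H. 0 \<le> weight H e) \<and>
     (\<forall>u. 0 < degree_of H u)"

definition covering :: "'v::finite hypergraph \<Rightarrow> bool" where
  "covering H \<longleftrightarrow> (\<forall>u v. u \<noteq> v \<longrightarrow> (\<exists>e\<in>hyperedges H. {u, v} \<subseteq> e))"

definition volume :: "'v::finite hypergraph \<Rightarrow> 'v set \<Rightarrow> real" where
  "volume H S = (\<Sum>v\<in>S. degree_of H v)"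

definition edge_boundary :: "'v::finite hypergraph \<Rightarrow> 'v set \<Rightarrow> 'v set set" where
  "edge_boundary H S = {e \<in> hyperedges H. e \<inter> S \<noteq> {} \<and> e \<inter> (- S) \<noteq> {}}"

definition diffusion_conductance_set :: "'v::finite hypergraph \<Rightarrow> 'v set \<Rightarrow> real" where
  "diffusion_conductance_set H S =
     (\<Sum>e\<in>edge_boundary H S.
        weight H e / (real (card e) - 1) * real (card (e \<inter> S)) * real (card (e \<inter> (- S))))
     / min (volume H S) (volume H (- S))"

text \<open>The minimum ranges over a nonempty set only if there are at least two vertices, as is the
  case for every non-covering hypergraph.\<close>

definition diffusion_conductance :: "'v::finite hypergraph \<Rightarrow> real" where
  "diffusion_conductance H = Min (diffusion_conductance_set H ` {S. {} \<subset> S \<and> S \<subset> UNIV})"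

definition adjacency_matrix :: "'v::finite hypergraph \<Rightarrow> real ^ 'v ^ 'v" where
  "adjacency_matrix H =
     (\<chi> u v. if u = v then 0
             else (\<Sum>e\<in>{e \<in> hyperedges H. {u, v} \<subseteq> e}. weight H e / (real (card e) - 1)))"

definition diagonal_matrix :: "('v::finite \<Rightarrow> real) \<Rightarrow> real ^ 'v ^ 'v" where
  "diagonal_matrix d = (\<chi> u v. if u = v then d u else 0)"

definition laplacian :: "'v::finite hypergraph \<Rightarrow> real ^ 'v ^ 'v" where
  "laplacian H = diagonal_matrix (degree_of H) - adjacency_matrix H"

definition normalized_laplacian :: "'v::finite hypergraph \<Rightarrow> real ^ 'v ^ 'v" where
  "normalized_laplacian H =
     diagonal_matrix (\<lambda>u. 1 / sqrt (degree_of H u)) ** laplacian H **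
     diagonal_matrix (\<lambda>u. 1 / sqrt (degree_of H u))"

definition characteristic_polynomial :: "real ^ 'v ^ 'v \<Rightarrow> real poly" where
  "characteristic_polynomial M = det (mat [:0, 1:] - (\<chi> u v. [:M $ u $ v:]))"

text \<open>The real eigenvalues with algebraic multiplicity, in nondecreasing order. A symmetric matrix
  has only real eigenvalues, so for it the list has length \<open>CARD('v)\<close>. The \<open>k\<close>-th smallest
  eigenvalue is counted from 1, and is meaningful for \<open>1 \<le> k \<le> CARD('v)\<close>.\<close>

definition sorted_eigenvalues :: "real ^ 'v ^ 'v \<Rightarrow> real list" where
  "sorted_eigenvalues M = sorted_list_of_multiset (proots (characteristic_polynomial M))"

definition nth_eigenvalue :: "'v::finite hypergraph \<Rightarrow> nat \<Rightarrow> real" (\<open>\<nu>\<close>) where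
  "\<nu> H k = sorted_eigenvalues (normalized_laplacian H) ! (k - 1)"

end

theory Submission
  imports Defs
begin

text \<open>
  The hypergraph enters only through its adjacency matrix, which is a weighted graph \<open>W\<close> on the
  same vertices: its row sums are the degrees of the hypergraph (\<open>adjacency_row_sum\<close>), and its cuts
  are the numerators of the diffusion conductance (\<open>adjacency_cut\<close>). The theorem is therefore a
  Cheeger inequality for \<open>W\<close>, in the sharp form with the factor \<open>2 - \<nu>\<^sub>2\<close>, where \<open>\<nu>\<^sub>2\<close> is the second
  eigenvalue.

  The eigenvalue \<open>\<nu>\<^sub>2\<close>, a root of the characteristic polynomial, is the minimum of the Rayleigh
  quotient \<open>energy g / (\<Sum>u. deg u * (g u)\<^sup>2)\<close> over nonzero functions \<open>g\<close> of weighted mean 0, and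
  the minimum is attained at an eigenfunction (\<open>second_eigenvalue_variational\<close>,
  \<open>spectral_gap_of_hypergraph\<close>). Indicators of vertex sets, shifted to mean 0, give the lower bound
  on the conductance (\<open>cheeger_lower_bound\<close>).

  For the upper bound, let \<open>p\<close> be the positive part of an eigenfunction \<open>g\<close>, after a change of sign if
  the set where \<open>g\<close> is positive has more than half of the volume. The Rayleigh quotient \<open>R\<close> of \<open>p\<close> is
  at most \<open>\<nu>\<^sub>2\<close>. Every superlevel set of \<open>p\<^sup>2\<close> at a positive level expands by the conductance \<open>\<phi>\<close>, so
  the total variation of \<open>p\<^sup>2\<close> is at least \<open>\<phi> * (\<Sum>u. deg u * (p u)\<^sup>2)\<close> (\<open>coarea_inequality\<close>), while
  the Cauchy--Schwarz inequality for the products \<open>(p u - p v) * (p u + p v)\<close> bounds it above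
  (\<open>square_total_variation_le\<close>). Together, \<open>\<phi>\<^sup>2 \<le> R * (2 - R)\<close>.

  Replacing \<open>R\<close> by \<open>\<nu>\<^sub>2\<close> requires \<open>\<nu>\<^sub>2 \<le> 1\<close>, since \<open>t * (2 - t)\<close> decreases beyond 1. This is where the
  hypergraph must be non-covering: two vertices in no common hyperedge are nonadjacent in \<open>W\<close>, and a
  function of mean 0 supported on them has Rayleigh quotient 1 (\<open>gap_le_1_if_nonadjacent\<close>).
\<close>

section \<open>The second eigenvalue of a positive semidefinite matrix\<close>

text \<open>Compactness of the unit sphere gives a minimizer of the Rayleigh quotient, and the first-order
  condition at a minimizer is the eigenvector equation. Invariance of \<open>S\<close> is what allows the
  residual \<open>f b - m *\<^sub>R b\<close> itself to serve as the direction of variation.\<close>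

lemma rayleigh_minimizer_eigenvector:
  fixes f :: "'a::euclidean_space \<Rightarrow> 'a"
  assumes lin: "linear f" and self_adj: "\<And>x y. f x \<bullet> y = x \<bullet> f y"
    and S: "subspace S" "S \<noteq> {0}" and inv: "\<And>x. x \<in> S \<Longrightarrow> f x \<in> S"
  obtains b m where "b \<in> S" "norm b = 1" "f b = m *\<^sub>R b"
    "\<And>x. x \<in> S \<Longrightarrow> m * (x \<bullet> x) \<le> x \<bullet> f x"
proof -
  let ?K = "S \<inter> sphere 0 1"
  obtain a where a: "a \<in> S" "a \<noteq> 0"
    using S subspace_0 by blast
  have "a /\<^sub>R norm a \<in> ?K"
    using a S(1) by (simp add: subspace_scale)
  then have "?K \<noteq> {}" by blast
  moreover have "compact ?K"
    by (simp add: closed_Int_compact closed_subspace S(1))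
  moreover have "continuous_on ?K (\<lambda>x. x \<bullet> f x)"
    by (intro continuous_intros linear_continuous_on linear_conv_bounded_linear[THEN iffD1] lin)
  ultimately obtain b where b: "b \<in> ?K" and least: "\<And>x. x \<in> ?K \<Longrightarrow> b \<bullet> f b \<le> x \<bullet> f x"
    using continuous_attains_inf[of ?K "\<lambda>x. x \<bullet> f x"] by blast
  define m where "m = b \<bullet> f b"
  have bS: "b \<in> S" and nb: "norm b = 1" and bb: "b \<bullet> b = 1"
    using b by (auto simp: norm_eq_1)
  have bound: "m * (x \<bullet> x) \<le> x \<bullet> f x" if x: "x \<in> S" for x
  proof (cases "x = 0")
    case False
    have "x /\<^sub>R norm x \<in> ?K"
      using x S(1) False by (simp add: subspace_scale)
    then have "m \<le> (x /\<^sub>R norm x) \<bullet> f (x /\<^sub>R norm x)"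
      using least m_def by blast
    also have "\<dots> = (x \<bullet> f x) / (norm x)\<^sup>2"
      by (simp add: linear_scale[OF lin] power2_eq_square divide_inverse)
    finally show ?thesis
      using False by (simp add: pos_le_divide_eq dot_square_norm)
  qed simp
  define y where "y = f b - m *\<^sub>R b"
  have y: "y \<in> S"
    unfolding y_def using bS inv S(1) by (simp add: subspace_diff subspace_scale)
  have yb: "y \<bullet> b = 0"
    using bb by (simp add: y_def inner_diff_left m_def inner_commute[of b "f b"])
  have yfb: "y \<bullet> f b = y \<bullet> y"
    using yb by (simp add: y_def inner_diff_right)
  define q where "q = y \<bullet> f y - m * (y \<bullet> y)"
  \<comment> \<open>The form \<open>x \<bullet> f x - m * (x \<bullet> x)\<close> is nonnegative on \<open>S\<close> and vanishes at \<open>b\<close>, so its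
    first-order term in the direction \<open>y\<close> must vanish.\<close>
  have quad: "0 \<le> 2 * t * (y \<bullet> y) + t\<^sup>2 * q" for t
  proof -
    let ?x = "b + t *\<^sub>R y"
    have "?x \<in> S"
      using bS y S(1) by (simp add: subspace_add subspace_scale)
    from bound[OF this] have "m * (?x \<bullet> ?x) \<le> ?x \<bullet> f ?x" .
    moreover have "f ?x = f b + t *\<^sub>R f y"
      by (simp add: linear_add[OF lin] linear_scale[OF lin])
    moreover have "b \<bullet> f y = y \<bullet> y"
      using self_adj[of b y] yfb by (simp add: inner_commute)
    ultimately show ?thesis
      using yb yfb bb
      by (simp add: inner_add_left inner_add_right m_def[symmetric] q_def algebra_simps
          power2_eq_square inner_commute)
  qed
  \<comment> \<open>A positive \<open>y \<bullet> y\<close> is refuted by a negative \<open>t\<close> so small that the linear term outweighs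
    the quadratic one; the \<open>+ 1\<close> only guards against \<open>q = 0\<close>.\<close>
  have "y \<bullet> y = 0"
  proof (rule ccontr)
    assume "y \<bullet> y \<noteq> 0"
    then have pos: "0 < y \<bullet> y" by simp
    define t where "t = - (y \<bullet> y) / (\<bar>q\<bar> + 1)"
    have "0 \<le> t * (2 * (y \<bullet> y) + t * q)"
      using quad[of t] by (simp add: power2_eq_square algebra_simps)
    moreover have "t < 0"
      unfolding t_def using pos by (simp add: divide_neg_pos)
    ultimately have "2 * (y \<bullet> y) + t * q \<le> 0"
      by (simp add: zero_le_mult_iff)
    moreover have "t * q \<ge> - (y \<bullet> y)"
    proof -
      have "\<bar>t * q\<bar> = (y \<bullet> y) * (\<bar>q\<bar> / (\<bar>q\<bar> + 1))"
        using pos by (simp add: t_def abs_mult)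
      also have "\<dots> \<le> (y \<bullet> y) * 1"
        using pos by (intro mult_left_mono) auto
      finally show ?thesis by linarith
    qed
    ultimately show False using pos by linarith
  qed
  then have "f b = m *\<^sub>R b"
    by (simp add: y_def)
  then show ?thesis
    using that bS nb bound by blast
qed

text \<open>The spectral theorem, by induction on the dimension: the orthogonal complement in \<open>S\<close> of an
  eigenvector is again invariant. Invariant subspaces rather than the whole space are considered
  both for this induction and in order to apply it later to the complement of two prescribed
  eigenvectors.\<close>

lemma orthonormal_eigenbasis:
  fixes f :: "'a::euclidean_space \<Rightarrow> 'a"
  assumes lin: "linear f" and self_adj: "\<And>x y. f x \<bullet> y = x \<bullet> f y"
    and "subspace S" and "\<And>x. x \<in> S \<Longrightarrow> f x \<in> S"
  shows "\<exists>B. B \<subseteq> S \<and> pairwise orthogonal B \<and> (\<forall>b\<in>B. norm b = 1) \<and> span B = S \<and>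
    (\<forall>b\<in>B. \<exists>c. f b = c *\<^sub>R b)"
  using assms(3,4)
proof (induction "dim S" arbitrary: S rule: less_induct)
  case less
  show ?case
  proof (cases "S = {0}")
    case True
    then show ?thesis by (intro exI[of _ "{}"]) (auto simp: pairwise_def)
  next
    case False
    obtain b m where b: "b \<in> S" "norm b = 1" "f b = m *\<^sub>R b"
      using rayleigh_minimizer_eigenvector[OF lin self_adj less.prems(1) False less.prems(2)]
      by blast
    define T where "T = S \<inter> {x. b \<bullet> x = 0}"
    have bb: "b \<bullet> b = 1" using b(2) by (simp add: norm_eq_1)
    have T: "subspace T"
      unfolding T_def by (intro subspace_inter less.prems subspace_hyperplane)
    have "b \<notin> T" using bb by (simp add: T_def)
    moreover have "T \<subseteq> S" by (simp add: T_def)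
    ultimately have "T \<subset> S" using b(1) by blast
    then have "dim T < dim S"
      using T less.prems(1) by (metis dim_psubset span_eq_iff)
    moreover have "f x \<in> T" if "x \<in> T" for x
      using that less.prems(2) self_adj[of b x] b(3) by (auto simp: T_def)
    ultimately obtain B where B: "B \<subseteq> T" "pairwise orthogonal B" "\<forall>b\<in>B. norm b = 1"
      "span B = T" "\<forall>b\<in>B. \<exists>c. f b = c *\<^sub>R b"
      using less.hyps[of T] T by blast
    have "span (insert b B) = S"
    proof
      show "span (insert b B) \<subseteq> S"
        using b B(1) less.prems(1) by (intro span_minimal) (auto simp: T_def)
      show "S \<subseteq> span (insert b B)"
      proof
        fix x assume x: "x \<in> S"
        have "x - (b \<bullet> x) *\<^sub>R b \<in> T"
          using x b bb less.prems(1)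
          by (auto simp: T_def subspace_diff subspace_scale inner_diff_right)
        then have "x - (b \<bullet> x) *\<^sub>R b \<in> span B" using B by simp
        then show "x \<in> span (insert b B)" by (auto simp: span_insert)
      qed
    qed
    moreover have "pairwise orthogonal (insert b B)"
      using B(1,2) by (auto simp: pairwise_insert T_def orthogonal_def inner_commute)
    ultimately show ?thesis
      using b B by (intro exI[of _ "insert b B"]) (auto simp: T_def)
  qed
qed

lemma sum_constant_polys: "(\<Sum>i\<in>A. [:g i:]) = [:\<Sum>i\<in>A. g i:]"
  by (induction A rule: infinite_finite_induct) auto

lemma det_constant_poly_matrix:
  fixes Q :: "real ^ 'n ^ 'n"
  shows "det (\<chi> i j. [:Q $ i $ j:]) = [:det Q:]"
proof -
  have prod: "(\<Prod>i\<in>A. [:g i:]) = [:\<Prod>i\<in>A. g i:]" for A and g :: "'n \<Rightarrow> real"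
    by (induction A rule: infinite_finite_induct) (auto simp: one_pCons)
  have int: "(of_int k :: real poly) = [:of_int k:]" for k
    by (simp add: of_int_poly)
  show ?thesis
    unfolding det_def by (simp add: prod int sum_constant_polys mult.commute)
qed

text \<open>If \<open>Q\<close> has the basis vectors as columns, then \<open>(X - M) Q = Q D\<close> over the polynomial ring,
  where \<open>D\<close> is diagonal with entries \<open>X - l b\<close>. Taking determinants and cancelling \<open>det Q\<close> factors
  the characteristic polynomial. This turns eigenvectors, counted in a basis, into roots counted
  with algebraic multiplicity.\<close>

lemma characteristic_polynomial_eigenbasis:
  fixes M :: "real ^ 'n ^ 'n"
  assumes orth: "pairwise orthogonal B" and unit: "\<And>b. b \<in> B \<Longrightarrow> norm b = 1"
    and span: "span B = UNIV"
    and eig: "\<And>b. b \<in> B \<Longrightarrow> M *v b = l b *\<^sub>R b"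
  shows "characteristic_polynomial M = (\<Prod>b\<in>B. [:- l b, 1:])"
proof -
  have indep: "independent B"
    using orth unit by (intro pairwise_orthogonal_independent) force+
  then have fin: "finite B" and card: "card B = CARD('n)"
    using span by (auto simp: independent_imp_finite dim_eq_card_independent[symmetric]
        dim_span[symmetric, of B] simp del: dim_span)
  from finite_same_card_bij[OF finite fin, of "UNIV :: 'n set"] card
  obtain h :: "'n \<Rightarrow> real ^ 'n" where h: "bij_betw h UNIV B" by auto
  then have hB: "h i \<in> B" for i by (auto simp: bij_betw_def)
  have hinj: "h i = h j \<longleftrightarrow> i = j" for i j
    using h by (auto simp: bij_betw_def inj_on_def)
  define Q :: "real ^ 'n ^ 'n" where "Q = (\<chi> i j. h j $ i)"
  let ?C = "\<lambda>A :: real ^ 'n ^ 'n. \<chi> i j. [:A $ i $ j:]"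
  let ?D = "(\<chi> i j. if i = j then [:- l (h j), 1:] else 0) :: real poly ^ 'n ^ 'n"
  have "h i \<bullet> h j = (if i = j then 1 else 0)" for i j
  proof (cases "i = j")
    case True
    then show ?thesis using unit[OF hB[of j]] by (simp add: norm_eq_1)
  next
    case False
    then show ?thesis
      using orth hB[of i] hB[of j] hinj by (auto simp: pairwise_def orthogonal_def)
  qed
  then have "transpose Q ** Q = mat 1"
    by (simp add: vec_eq_iff matrix_matrix_mult_def transpose_def Q_def mat_def inner_vec_def)
  then have "det Q * det Q = 1"
    by (metis det_I det_mul det_transpose)
  then have detQ: "[:det Q:] \<noteq> 0" by auto
  have eig': "(\<Sum>k\<in>UNIV. M $ i $ k * h j $ k) = l (h j) * h j $ i" for i j
    using eig[OF hB[of j]] by (simp add: vec_eq_iff matrix_vector_mult_def)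
  have "(mat [:0, 1:] - ?C M) ** ?C Q = ?C Q ** ?D"
  proof -
    have "(\<Sum>k\<in>UNIV. ((if i = k then [:0, 1:] else 0) - [:M $ i $ k:]) * [:h j $ k:]) =
      (\<Sum>k\<in>UNIV. [:h k $ i:] * (if k = j then [:- l (h j), 1:] else 0))" for i j
    proof -
      have "(\<Sum>k\<in>UNIV. ((if i = k then [:0, 1:] else 0) - [:M $ i $ k:]) * [:h j $ k:]) =
        (\<Sum>k\<in>UNIV. (if i = k then [:0, 1:] * [:h j $ k:] else 0)) -
        (\<Sum>k\<in>UNIV. [:M $ i $ k * h j $ k:])"
        unfolding sum_subtractf[symmetric] by (intro sum.cong) (auto simp: algebra_simps)
      also have "\<dots> = [:0, 1:] * [:h j $ i:] - [:l (h j) * h j $ i:]"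
        by (simp add: sum_constant_polys eig')
      also have "\<dots> = [:h j $ i:] * [:- l (h j), 1:]" by simp
      also have "\<dots> = (\<Sum>k\<in>UNIV. if k = j then [:h k $ i:] * [:- l (h j), 1:] else 0)"
        by simp
      also have "\<dots> = (\<Sum>k\<in>UNIV. [:h k $ i:] * (if k = j then [:- l (h j), 1:] else 0))"
        by (intro sum.cong) auto
      finally show ?thesis .
    qed
    then show ?thesis
      by (simp add: vec_eq_iff matrix_matrix_mult_def Q_def mat_def)
  qed
  then have "det (mat [:0, 1:] - ?C M) * det (?C Q) = det (?C Q) * det ?D"
    unfolding det_mul[symmetric] by (rule arg_cong)
  then have "[:det Q:] * characteristic_polynomial M = [:det Q:] * det ?D"
    unfolding characteristic_polynomial_def det_constant_poly_matrix by (simp only: mult.commute)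
  then have "characteristic_polynomial M = det ?D"
    using detQ mult_left_cancel by blast
  also have "\<dots> = (\<Prod>i\<in>UNIV. [:- l (h i), 1:])"
    by (subst det_diagonal) auto
  also have "\<dots> = (\<Prod>b\<in>B. [:- l b, 1:])"
    using h by (rule prod.reindex_bij_betw)
  finally show ?thesis .
qed

text \<open>Since \<open>M\<close> is positive semidefinite, the kernel vector \<open>z\<close> realizes the smallest eigenvalue 0. The
  minimizer \<open>f\<close> of the Rayleigh quotient on the complement of \<open>z\<close> is an eigenvector, and every
  eigenvalue on the complement of \<open>z\<close> and \<open>f\<close> is at least as large as that of \<open>f\<close>, because it too
  is a value of the Rayleigh quotient. So the sorted spectrum starts with 0 and the minimum.\<close>

lemma second_eigenvalue_variational:
  fixes M :: "real ^ 'n ^ 'n"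
  assumes sym: "transpose M = M" and psd: "\<And>x. 0 \<le> x \<bullet> (M *v x)"
    and z: "z \<noteq> 0" "M *v z = 0" and card: "2 \<le> CARD('n)"
  obtains f where "f \<noteq> 0" "z \<bullet> f = 0" "M *v f = (sorted_eigenvalues M ! 1) *\<^sub>R f"
    "\<And>x. z \<bullet> x = 0 \<Longrightarrow> (sorted_eigenvalues M ! 1) * (x \<bullet> x) \<le> x \<bullet> (M *v x)"
proof -
  have lin: "linear ((*v) M)" by simp
  have self_adj: "(M *v x) \<bullet> y = x \<bullet> (M *v y)" for x y
    by (metis dot_lmul_matrix sym transpose_matrix_vector)
  define S where "S = {x. z \<bullet> x = 0}"
  have S: "subspace S" by (simp add: S_def subspace_hyperplane)
  have "dim S = CARD('n) - 1"
    using z(1) by (simp add: S_def dim_hyperplane)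
  then have S0: "S \<noteq> {0}" using card by auto
  have invS: "M *v x \<in> S" if "x \<in> S" for x
    using self_adj[of z x] z(2) by (simp add: S_def)
  obtain f m where f: "f \<in> S" "norm f = 1" "M *v f = m *\<^sub>R f"
    and m: "\<And>x. x \<in> S \<Longrightarrow> m * (x \<bullet> x) \<le> x \<bullet> (M *v x)"
    using rayleigh_minimizer_eigenvector[OF lin self_adj S S0 invS] by blast
  have ff: "f \<bullet> f = 1" using f(2) by (simp add: norm_eq_1)
  define T where "T = S \<inter> {x. f \<bullet> x = 0}"
  have T: "subspace T"
    unfolding T_def by (intro subspace_inter S subspace_hyperplane)
  have invT: "M *v x \<in> T" if "x \<in> T" for x
    using that self_adj[of f x] f(3) invS by (auto simp: T_def)
  obtain B where B: "B \<subseteq> T" "pairwise orthogonal B" "\<forall>b\<in>B. norm b = 1"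
    "span B = T" "\<forall>b\<in>B. \<exists>c. M *v b = c *\<^sub>R b"
    using orthonormal_eigenbasis[OF lin self_adj T invT] by blast
  have finB: "finite B"
    using B by (intro independent_imp_finite pairwise_orthogonal_independent) force+
  define e where "e = z /\<^sub>R norm z"
  have ne: "norm e = 1" and ee: "e \<bullet> e = 1"
    using z(1) by (auto simp: e_def dot_square_norm power2_eq_square)
  have Me: "M *v e = 0 *\<^sub>R e" by (simp add: e_def matrix_vector_mult_scaleR z(2))
  have ef: "e \<bullet> f = 0" using f(1) by (simp add: e_def S_def)
  have eB: "e \<bullet> b = 0" "f \<bullet> b = 0" if "b \<in> B" for b
    using B(1) that by (auto simp: T_def S_def e_def)
  have notin: "f \<notin> B" "e \<notin> B" "e \<noteq> f"
    using eB[of f] eB[of e] ee ff ef by auto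
  let ?B = "insert e (insert f B)"
  define l where "l b = b \<bullet> (M *v b)" for b
  have eig: "M *v b = l b *\<^sub>R b" if "b \<in> ?B" for b
  proof -
    obtain c where "M *v b = c *\<^sub>R b" and "b \<bullet> b = 1"
      using B(3,5) \<open>b \<in> ?B\<close> f ff ee Me by (fastforce simp: norm_eq_1)
    then show ?thesis by (simp add: l_def)
  qed
  have "x \<in> span ?B" for x
  proof -
    have zx: "z \<bullet> e = norm z" by (simp add: e_def dot_square_norm power2_eq_square z(1))
    have "z \<bullet> x = norm z * (e \<bullet> x)" using z(1) by (simp add: e_def)
    then have "x - (e \<bullet> x) *\<^sub>R e - (f \<bullet> x) *\<^sub>R f \<in> T"
      using zx f(1) ff ef by (simp add: T_def S_def inner_diff_right inner_commute)
    then have "x - (e \<bullet> x) *\<^sub>R e - (f \<bullet> x) *\<^sub>R f \<in> span B" using B(4) by simp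
    then show ?thesis unfolding span_insert by blast
  qed
  then have "span ?B = UNIV" by blast
  moreover have "pairwise orthogonal ?B"
    using B(2) eB ef by (auto simp: pairwise_insert orthogonal_def inner_commute)
  ultimately have "characteristic_polynomial M = (\<Prod>b\<in>?B. [:- l b, 1:])"
    using B(3) ne f(2) eig by (intro characteristic_polynomial_eigenbasis) auto
  then have "proots (characteristic_polynomial M) = (\<Sum>b\<in>?B. {#l b#})"
    by (simp add: proots_prod)
  moreover have "l e = 0" "l f = m" using Me f(3) ff by (simp_all add: l_def)
  ultimately have roots: "proots (characteristic_polynomial M) = {#0, m#} + (\<Sum>b\<in>B. {#l b#})"
    using finB notin by simp
  define N where "N = (\<Sum>b\<in>B. {#l b#})"
  have N: "m \<le> x" if x: "x \<in># N" for x
  proof -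
    obtain b where b: "b \<in> B" "x = l b"
      using x finB by (auto simp: N_def set_mset_sum)
    then have "b \<in> S" "b \<bullet> b = 1" using B(1,3) by (auto simp: T_def norm_eq_1)
    then show ?thesis using m[of b] b by (simp add: l_def)
  qed
  have m0: "0 \<le> m" using psd[of f] f(3) ff by simp
  obtain ys where ys: "sorted ys" "mset ys = N"
    by (metis mset_sorted_list_of_multiset sorted_sorted_list_of_multiset)
  have "sorted (0 # m # ys)"
    using ys N m0 by (fastforce simp flip: set_mset_mset)
  moreover have "mset (0 # m # ys) = proots (characteristic_polynomial M)"
    using roots ys(2) by (simp add: N_def)
  ultimately have "sorted_eigenvalues M = 0 # m # ys"
    unfolding sorted_eigenvalues_def
    by (metis sorted_list_of_multiset_mset sort_key_id_if_sorted sorted_sort_id)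
  then have "sorted_eigenvalues M ! 1 = m" by simp
  moreover have "f \<noteq> 0" using f(2) by auto
  ultimately show ?thesis
    using that f m by (simp add: S_def)
qed

section \<open>Cheeger inequalities for weighted graphs\<close>

locale weighted_graph =
  fixes W :: "'v::finite \<Rightarrow> 'v \<Rightarrow> real"
  assumes W_sym: "W u v = W v u"
    and W_nonneg: "0 \<le> W u v"
begin

definition deg :: "'v \<Rightarrow> real" where
  "deg u = (\<Sum>v\<in>UNIV. W u v)"

definition vol :: "'v set \<Rightarrow> real" where
  "vol S = (\<Sum>u\<in>S. deg u)"

definition cut :: "'v set \<Rightarrow> real" where
  "cut S = (\<Sum>u\<in>S. \<Sum>v\<in>-S. W u v)"

definition energy :: "('v \<Rightarrow> real) \<Rightarrow> real" where
  "energy g = (\<Sum>u\<in>UNIV. \<Sum>v\<in>UNIV. W u v * (g u - g v)\<^sup>2) / 2"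

lemma deg_nonneg: "0 \<le> deg u"
  by (simp add: deg_def W_nonneg sum_nonneg)

lemma vol_nonneg: "0 \<le> vol S"
  by (simp add: vol_def deg_nonneg sum_nonneg)

lemma cut_nonneg: "0 \<le> cut S"
  by (simp add: cut_def W_nonneg sum_nonneg)

lemma energy_nonneg: "0 \<le> energy g"
  by (simp add: energy_def W_nonneg sum_nonneg)

lemma vol_mono: "S \<subseteq> T \<Longrightarrow> vol S \<le> vol T"
  unfolding vol_def by (rule sum_mono2) (auto simp: deg_nonneg)

lemma double_sum_swap:
  "(\<Sum>u\<in>UNIV. \<Sum>v\<in>UNIV. W u v * h v u) = (\<Sum>u\<in>UNIV. \<Sum>v\<in>UNIV. W u v * h u v)"
  by (subst sum.swap) (simp add: W_sym)

lemma energy_eq_laplacian_form: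
  "energy g = (\<Sum>u\<in>UNIV. g u * (\<Sum>v\<in>UNIV. W u v * (g u - g v)))"
proof -
  let ?A = "\<Sum>u\<in>UNIV. \<Sum>v\<in>UNIV. W u v * (g u * (g u - g v))"
  have "2 * energy g = (\<Sum>u\<in>UNIV. \<Sum>v\<in>UNIV. W u v * (g u * (g u - g v)) + W u v * (g v * (g v - g u)))"
    unfolding energy_def by (simp add: algebra_simps power2_eq_square)
  also have "\<dots> = ?A + (\<Sum>u\<in>UNIV. \<Sum>v\<in>UNIV. W u v * (g v * (g v - g u)))"
    by (simp add: sum.distrib)
  also have "\<dots> = 2 * ?A"
    using double_sum_swap[of "\<lambda>u v. g u * (g u - g v)"] by simp
  finally have "energy g = ?A" by simp
  then show ?thesis
    by (simp add: sum_distrib_left mult.left_commute)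
qed

lemma sum_deg_mult: "(\<Sum>u\<in>UNIV. \<Sum>v\<in>UNIV. W u v * h u) = (\<Sum>u\<in>UNIV. deg u * h u)"
  by (simp add: deg_def sum_distrib_right)

lemma sum_deg_mult': "(\<Sum>u\<in>UNIV. \<Sum>v\<in>UNIV. W u v * h v) = (\<Sum>u\<in>UNIV. deg u * h u)"
  using double_sum_swap[of "\<lambda>u v. h u"] by (simp add: sum_deg_mult)

lemma energy_eq_adjacency_form:
  "energy g = (\<Sum>u\<in>UNIV. deg u * (g u)\<^sup>2) - (\<Sum>u\<in>UNIV. \<Sum>v\<in>UNIV. W u v * (g u * g v))"
proof -
  have "energy g = (\<Sum>u\<in>UNIV. \<Sum>v\<in>UNIV. W u v * (g u)\<^sup>2 - W u v * (g u * g v))"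
    unfolding energy_eq_laplacian_form
    by (simp add: sum_distrib_left algebra_simps power2_eq_square)
  then show ?thesis
    by (simp add: sum_subtractf sum_deg_mult[of "\<lambda>u. (g u)\<^sup>2"])
qed

text \<open>The signless energy complements the energy, as \<open>(a - b)\<^sup>2 + (a + b)\<^sup>2 = 2 a\<^sup>2 + 2 b\<^sup>2\<close>. Keeping this
  identity exact, instead of bounding the left-hand side by its first term on the right, is the source
  of the factor \<open>2 - m\<close> in the upper Cheeger bound.\<close>

lemma sum_plus_squares:
  "(\<Sum>u\<in>UNIV. \<Sum>v\<in>UNIV. W u v * (g u + g v)\<^sup>2) = 2 * (2 * (\<Sum>u\<in>UNIV. deg u * (g u)\<^sup>2) - energy g)"
proof -
  have "(\<Sum>u\<in>UNIV. \<Sum>v\<in>UNIV. W u v * (g u + g v)\<^sup>2) =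
    (\<Sum>u\<in>UNIV. \<Sum>v\<in>UNIV. 2 * (W u v * (g u)\<^sup>2) + 2 * (W u v * (g v)\<^sup>2) - W u v * (g u - g v)\<^sup>2)"
    by (simp add: algebra_simps power2_eq_square)
  also have "\<dots> = 2 * (\<Sum>u\<in>UNIV. deg u * (g u)\<^sup>2) + 2 * (\<Sum>u\<in>UNIV. deg u * (g u)\<^sup>2) - 2 * energy g"
    unfolding sum_deg_mult[symmetric, of "\<lambda>u. (g u)\<^sup>2"]
    by (simp add: sum.distrib sum_subtractf sum_distrib_left[symmetric] energy_def
        sum_deg_mult[of "\<lambda>u. (g u)\<^sup>2"] sum_deg_mult'[of "\<lambda>u. (g u)\<^sup>2"])
  finally show ?thesis by simp
qed

lemma cut_eq_double_sum:
  "(\<Sum>u\<in>UNIV. \<Sum>v\<in>UNIV. W u v * (if u \<in> S \<longleftrightarrow> v \<in> S then 0 else c)) = 2 * (c * cut S)"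
proof -
  let ?h = "\<lambda>u v. if u \<in> S \<and> v \<notin> S then c else 0"
  have one: "(\<Sum>u\<in>UNIV. \<Sum>v\<in>UNIV. W u v * ?h u v) = c * cut S"
  proof -
    have "(\<Sum>v\<in>UNIV. W u v * ?h u v) = (if u \<in> S then c * (\<Sum>v\<in>-S. W u v) else 0)" for u
      by (auto simp: sum_distrib_left mult.commute if_distrib[of "\<lambda>x. _ * x"] sum.If_cases
          Compl_eq intro!: sum.cong)
    then show ?thesis
      by (simp add: cut_def sum.If_cases sum_distrib_left)
  qed
  have "(\<Sum>u\<in>UNIV. \<Sum>v\<in>UNIV. W u v * (if u \<in> S \<longleftrightarrow> v \<in> S then 0 else c)) =
    (\<Sum>u\<in>UNIV. \<Sum>v\<in>UNIV. W u v * ?h u v + W u v * ?h v u)"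
    by (intro sum.cong refl) auto
  also have "\<dots> = 2 * (c * cut S)"
    using one double_sum_swap[of ?h] by (simp add: sum.distrib)
  finally show ?thesis .
qed

text \<open>A nonnegative function is a sum of positive multiples of the indicators of its superlevel sets,
  and along such a nested sum both sides are additive; on a single indicator the claim is the
  expansion hypothesis. The induction on the size of the support peels off one layer at a time.\<close>

lemma coarea_inequality:
  assumes "\<And>u. 0 \<le> q u"
    and "\<And>S. S \<noteq> {} \<Longrightarrow> S \<subseteq> {u. q u \<noteq> 0} \<Longrightarrow> \<phi> * vol S \<le> cut S"
  shows "2 * (\<phi> * (\<Sum>u\<in>UNIV. deg u * q u)) \<le> (\<Sum>u\<in>UNIV. \<Sum>v\<in>UNIV. W u v * \<bar>q u - q v\<bar>)"
  using assms
proof (induction "card {u. q u \<noteq> 0}" arbitrary: q rule: less_induct)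
  case less
  define S where "S = {u. q u \<noteq> 0}"
  show ?case
  proof (cases "S = {}")
    case True
    then have "q = (\<lambda>_. 0)" by (auto simp: S_def)
    then show ?thesis by simp
  next
    case False
    \<comment> \<open>Peel off the bottom layer \<open>t * 1\<^sub>S\<close>.\<close>
    define t where "t = Min (q ` S)"
    define r where "r u = (if u \<in> S then q u - t else 0)" for u
    have "t \<in> q ` S" using False by (simp add: t_def)
    then obtain a where a: "a \<in> S" "q a = t" by auto
    have le: "t \<le> q u" if "u \<in> S" for u using that by (simp add: t_def)
    have t0: "0 \<le> t" using a less.prems(1)[of a] by simp
    have supp: "{u. r u \<noteq> 0} \<subset> S" using a by (auto simp: r_def)
    have IH: "2 * (\<phi> * (\<Sum>u\<in>UNIV. deg u * r u)) \<le> (\<Sum>u\<in>UNIV. \<Sum>v\<in>UNIV. W u v * \<bar>r u - r v\<bar>)"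
    proof (rule less.hyps)
      show "card {u. r u \<noteq> 0} < card {u. q u \<noteq> 0}"
        using supp by (intro psubset_card_mono) (auto simp: S_def)
      show "0 \<le> r u" for u using le by (simp add: r_def)
      show "\<phi> * vol T \<le> cut T" if "T \<noteq> {}" "T \<subseteq> {u. r u \<noteq> 0}" for T
        using less.prems(2)[OF that(1)] that(2) supp by (auto simp: S_def)
    qed
    have "\<phi> * vol S \<le> cut S"
      using less.prems(2)[OF False] by (simp add: S_def)
    then have layer: "2 * (\<phi> * (t * vol S)) \<le> 2 * (t * cut S)"
      using mult_left_mono[of "\<phi> * vol S" "cut S" t] t0 by (simp add: mult.left_commute)
    have "(\<Sum>u\<in>UNIV. deg u * q u) = (\<Sum>u\<in>UNIV. deg u * r u + (if u \<in> S then t * deg u else 0))"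
      by (intro sum.cong refl) (auto simp: r_def S_def algebra_simps)
    also have "\<dots> = (\<Sum>u\<in>UNIV. deg u * r u) + t * vol S"
      by (simp add: sum.distrib sum.If_cases vol_def sum_distrib_left)
    finally have lhs: "(\<Sum>u\<in>UNIV. deg u * q u) = (\<Sum>u\<in>UNIV. deg u * r u) + t * vol S" .
    have "\<bar>q u - q v\<bar> = \<bar>r u - r v\<bar> + (if u \<in> S \<longleftrightarrow> v \<in> S then 0 else t)" for u v
      using le[of u] le[of v] t0 by (auto simp: r_def S_def)
    then have "(\<Sum>u\<in>UNIV. \<Sum>v\<in>UNIV. W u v * \<bar>q u - q v\<bar>) =
      (\<Sum>u\<in>UNIV. \<Sum>v\<in>UNIV. W u v * \<bar>r u - r v\<bar>) + 2 * (t * cut S)"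
      by (simp add: distrib_left sum.distrib cut_eq_double_sum)
    then show ?thesis
      using IH layer lhs by (simp add: distrib_left)
  qed
qed

text \<open>The Cauchy--Schwarz inequality over all ordered pairs, applied to
  \<open>\<bar>p u - p v\<bar>\<close> and \<open>\<bar>p u + p v\<bar>\<close> weighted by \<open>sqrt (W u v)\<close>.\<close>

lemma square_total_variation_le:
  "(\<Sum>u\<in>UNIV. \<Sum>v\<in>UNIV. W u v * \<bar>(p u)\<^sup>2 - (p v)\<^sup>2\<bar>)\<^sup>2
     \<le> 4 * (energy p * (2 * (\<Sum>u\<in>UNIV. deg u * (p u)\<^sup>2) - energy p))"
proof -
  let ?a = "\<lambda>(u, v). sqrt (W u v) * \<bar>p u - p v\<bar>"
  let ?b = "\<lambda>(u, v). sqrt (W u v) * \<bar>p u + p v\<bar>"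
  have ab: "?a (u, v) * ?b (u, v) = W u v * \<bar>(p u)\<^sup>2 - (p v)\<^sup>2\<bar>" for u v
  proof -
    have "(p u)\<^sup>2 - (p v)\<^sup>2 = (p u - p v) * (p u + p v)"
      by (simp add: power2_eq_square algebra_simps)
    then have "W u v * \<bar>(p u)\<^sup>2 - (p v)\<^sup>2\<bar> =
        (sqrt (W u v) * sqrt (W u v)) * (\<bar>p u - p v\<bar> * \<bar>p u + p v\<bar>)"
      by (simp add: W_nonneg abs_mult)
    then show ?thesis by (simp add: mult.assoc mult.left_commute)
  qed
  have a2: "(?a (u, v))\<^sup>2 = W u v * (p u - p v)\<^sup>2" and b2: "(?b (u, v))\<^sup>2 = W u v * (p u + p v)\<^sup>2" for u v
    by (simp_all add: power_mult_distrib W_nonneg)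
  have "(\<Sum>x\<in>UNIV \<times> UNIV. ?a x * ?b x)\<^sup>2 \<le> (\<Sum>x\<in>UNIV \<times> UNIV. (?a x)\<^sup>2) * (\<Sum>x\<in>UNIV \<times> UNIV. (?b x)\<^sup>2)"
    by (rule Cauchy_Schwarz_ineq_sum)
  moreover have "(\<Sum>x\<in>UNIV \<times> UNIV. ?a x * ?b x) = (\<Sum>u\<in>UNIV. \<Sum>v\<in>UNIV. W u v * \<bar>(p u)\<^sup>2 - (p v)\<^sup>2\<bar>)"
    by (simp only: sum.cartesian_product ab[symmetric]) (simp add: case_prod_unfold)
  moreover have "(\<Sum>x\<in>UNIV \<times> UNIV. (?a x)\<^sup>2) = 2 * energy p"
    by (simp only: sum.cartesian_product energy_def a2[symmetric]) (simp add: case_prod_unfold)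
  moreover have "(\<Sum>x\<in>UNIV \<times> UNIV. (?b x)\<^sup>2) = 2 * (2 * (\<Sum>u\<in>UNIV. deg u * (p u)\<^sup>2) - energy p)"
    by (simp only: sum.cartesian_product sum_plus_squares[symmetric] b2[symmetric])
      (simp add: case_prod_unfold)
  ultimately have "(\<Sum>u\<in>UNIV. \<Sum>v\<in>UNIV. W u v * \<bar>(p u)\<^sup>2 - (p v)\<^sup>2\<bar>)\<^sup>2
     \<le> (2 * energy p) * (2 * (2 * (\<Sum>u\<in>UNIV. deg u * (p u)\<^sup>2) - energy p))"
    by (simp only:)
  then show ?thesis by (simp only: mult.assoc mult.left_commute)
qed

text \<open>Combining the coarea inequality for \<open>p\<^sup>2\<close> with the Cauchy--Schwarz bound gives
  \<open>\<phi>\<^sup>2 \<le> R (2 - R)\<close>, where \<open>R\<close> is the Rayleigh quotient of \<open>p\<close>. The right-hand side increases in \<open>R\<close>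
  only up to \<open>R = 1\<close>, so \<open>R\<close> can be replaced by its upper bound \<open>m\<close> just because \<open>m \<le> 1\<close>.\<close>

lemma conductance_le_rayleigh:
  assumes "0 \<le> \<phi>"
    and exp: "\<And>S. S \<noteq> {} \<Longrightarrow> S \<subseteq> {u. p u \<noteq> 0} \<Longrightarrow> \<phi> * vol S \<le> cut S"
    and N: "0 < (\<Sum>u\<in>UNIV. deg u * (p u)\<^sup>2)"
    and E: "energy p \<le> m * (\<Sum>u\<in>UNIV. deg u * (p u)\<^sup>2)" and "m \<le> 1"
  shows "\<phi>\<^sup>2 \<le> (2 - m) * m"
proof -
  define n where "n = (\<Sum>u\<in>UNIV. deg u * (p u)\<^sup>2)"
  have mn: "(n - m * n)\<^sup>2 \<le> (n - energy p)\<^sup>2"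
    using E \<open>m \<le> 1\<close> N mult_right_mono[of m 1 n] by (intro power_mono) (auto simp: n_def)
  have "2 * (\<phi> * n) \<le> (\<Sum>u\<in>UNIV. \<Sum>v\<in>UNIV. W u v * \<bar>(p u)\<^sup>2 - (p v)\<^sup>2\<bar>)"
    unfolding n_def by (rule coarea_inequality) (auto intro: exp)
  then have "(2 * (\<phi> * n))\<^sup>2 \<le> (\<Sum>u\<in>UNIV. \<Sum>v\<in>UNIV. W u v * \<bar>(p u)\<^sup>2 - (p v)\<^sup>2\<bar>)\<^sup>2"
    using N assms(1) by (intro power_mono) (auto simp: n_def)
  also have "\<dots> \<le> 4 * (energy p * (2 * n - energy p))"
    unfolding n_def by (rule square_total_variation_le)
  also have "energy p * (2 * n - energy p) = n\<^sup>2 - (n - energy p)\<^sup>2"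
    by (simp add: power2_eq_square algebra_simps)
  finally have "(2 * (\<phi> * n))\<^sup>2 \<le> 4 * (n\<^sup>2 - (n - energy p)\<^sup>2)" .
  also have "\<dots> \<le> 4 * (n\<^sup>2 - (n - m * n)\<^sup>2)" using mn by simp
  also have "\<dots> = 4 * (((2 - m) * m) * n\<^sup>2)"
    by (simp add: power2_eq_square algebra_simps)
  finally have "\<phi>\<^sup>2 * n\<^sup>2 \<le> ((2 - m) * m) * n\<^sup>2"
    by (simp add: power_mult_distrib)
  then show ?thesis
    using N by (simp add: n_def)
qed

text \<open>Cutting off the negative part of an eigenfunction does not raise its Rayleigh quotient: at a vertex
  where \<open>g\<close> is positive the differences \<open>g u - g v\<close> can only shrink, and elsewhere the cut-off function
  vanishes.\<close>

lemma energy_positive_part: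
  fixes g :: "'v \<Rightarrow> real"
  assumes "\<And>u. (\<Sum>v\<in>UNIV. W u v * (g u - g v)) = m * (deg u * g u)"
  defines "p \<equiv> \<lambda>u. max 0 (g u)"
  shows "energy p \<le> m * (\<Sum>u\<in>UNIV. deg u * (p u)\<^sup>2)"
proof -
  have "p u * (\<Sum>v\<in>UNIV. W u v * (p u - p v)) \<le> m * (deg u * (p u)\<^sup>2)" for u
  proof (cases "0 < g u")
    case True
    then have "(\<Sum>v\<in>UNIV. W u v * (p u - p v)) \<le> (\<Sum>v\<in>UNIV. W u v * (g u - g v))"
      by (intro sum_mono mult_left_mono W_nonneg) (auto simp: p_def)
    also have "\<dots> = m * (deg u * p u)" using assms(1)[of u] True by (simp add: p_def)
    finally have "p u * (\<Sum>v\<in>UNIV. W u v * (p u - p v)) \<le> p u * (m * (deg u * p u))"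
      by (intro mult_left_mono) (auto simp: p_def)
    then show ?thesis by (simp add: power2_eq_square algebra_simps)
  qed (simp add: p_def)
  then show ?thesis
    unfolding energy_eq_laplacian_form sum_distrib_left by (intro sum_mono)
qed

text \<open>The positive and negative supports of \<open>g\<close> are disjoint, so one of them has at most half of the
  total volume. After a possible change of sign, for every subset of the support of the positive
  part the minimum in the expansion hypothesis is the volume of that subset.\<close>

lemma cheeger_upper_bound:
  assumes deg: "\<And>u. 0 < deg u" and g: "g \<noteq> (\<lambda>_. 0)"
    and mean: "(\<Sum>u\<in>UNIV. deg u * g u) = 0"
    and eig: "\<And>u. (\<Sum>v\<in>UNIV. W u v * (g u - g v)) = m * (deg u * g u)" and "m \<le> 1"
    and "0 \<le> \<phi>"
    and exp: "\<And>S. {} \<subset> S \<Longrightarrow> S \<subset> UNIV \<Longrightarrow> \<phi> * min (vol S) (vol (- S)) \<le> cut S"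
  shows "\<phi>\<^sup>2 \<le> (2 - m) * m"
proof -
  have main: ?thesis
    if h: "\<And>u. (\<Sum>v\<in>UNIV. W u v * (h u - h v)) = m * (deg u * h u)"
      and P: "{u. 0 < h u} \<noteq> {}" "vol {u. 0 < h u} \<le> vol (- {u. 0 < h u})" for h
  proof (rule conductance_le_rayleigh[of _ "\<lambda>u. max 0 (h u)"])
    obtain a where a: "0 < h a" using P(1) by auto
    show "0 < (\<Sum>u\<in>UNIV. deg u * (max 0 (h u))\<^sup>2)"
      by (rule sum_pos2[of _ a]) (use a deg in \<open>auto simp: deg_nonneg\<close>)
    show "energy (\<lambda>u. max 0 (h u)) \<le> m * (\<Sum>u\<in>UNIV. deg u * (max 0 (h u))\<^sup>2)"
      using h by (rule energy_positive_part)
    show "\<phi> * vol S \<le> cut S" if S: "S \<noteq> {}" "S \<subseteq> {u. max 0 (h u) \<noteq> 0}" for S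
    proof -
      have SP: "S \<subseteq> {u. 0 < h u}" using S(2) by (auto simp: max_def split: if_splits)
      then have "vol S \<le> vol {u. 0 < h u}" by (rule vol_mono)
      also note P(2)
      also have "vol (- {u. 0 < h u}) \<le> vol (- S)" using SP by (intro vol_mono) auto
      finally have half: "vol S \<le> vol (- S)" .
      have "S \<noteq> UNIV"
      proof
        assume "S = UNIV"
        then have "vol S \<le> 0" using half by (simp add: vol_def)
        moreover have "0 < vol S"
          unfolding vol_def using S(1) deg by (intro sum_pos) auto
        ultimately show False by simp
      qed
      then show ?thesis using exp[of S] S(1) half by auto
    qed
  qed fact+
  \<comment> \<open>A nonzero function of weighted mean 0 takes positive values.\<close>
  have exists: "{u. 0 < h u} \<noteq> {}" if "h \<noteq> (\<lambda>_. 0)" "(\<Sum>u\<in>UNIV. deg u * h u) = 0" for h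
  proof
    assume "{u. 0 < h u} = {}"
    then have "h u \<le> 0" for u by (auto simp: not_less)
    then have "0 \<le> - (deg u * h u)" for u using deg_nonneg by (simp add: mult_nonneg_nonpos)
    moreover have "(\<Sum>u\<in>UNIV. - (deg u * h u)) = 0" using that(2) by (simp add: sum_negf)
    ultimately have "deg u * h u = 0" for u
      using sum_nonneg_eq_0_iff[of UNIV "\<lambda>u. - (deg u * h u)"] by simp
    then show False using that(1) deg by (auto simp: fun_eq_iff less_le)
  qed
  show ?thesis
  proof (cases "vol {u. 0 < g u} \<le> vol (- {u. 0 < g u})")
    case True
    then show ?thesis using main[of g] eig exists[OF g mean] by blast
  next
    case False
    let ?h = "\<lambda>u. - g u"
    have "vol {u. 0 < ?h u} \<le> vol (- {u. 0 < g u})" by (intro vol_mono) auto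
    also have "\<dots> \<le> vol {u. 0 < g u}" using False by simp
    also have "\<dots> \<le> vol (- {u. 0 < ?h u})" by (intro vol_mono) auto
    finally have "vol {u. 0 < ?h u} \<le> vol (- {u. 0 < ?h u})" .
    moreover have "(\<Sum>v\<in>UNIV. W u v * (?h u - ?h v)) = m * (deg u * ?h u)" for u
    proof -
      have "(\<Sum>v\<in>UNIV. W u v * (?h u - ?h v)) = - (\<Sum>v\<in>UNIV. W u v * (g u - g v))"
        unfolding sum_negf[symmetric] by (intro sum.cong) (auto simp: algebra_simps)
      then show ?thesis by (simp add: eig)
    qed
    moreover have "{u. 0 < ?h u} \<noteq> {}"
      using g mean by (intro exists) (auto simp: fun_eq_iff sum_negf)
    ultimately show ?thesis using main[of ?h] by blast
  qed
qed

text \<open>The test function is the indicator of \<open>S\<close> shifted to weighted mean 0 and scaled by the total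
  volume: it equals \<open>b\<close> on \<open>S\<close> and \<open>- a\<close> off \<open>S\<close>, where \<open>a\<close> and \<open>b\<close> are the volumes of \<open>S\<close> and its
  complement. The factor 1/2 comes from \<open>min a b * (a + b) \<le> 2 a b\<close>.\<close>

lemma cheeger_lower_bound:
  assumes "0 \<le> m"
    and gap: "\<And>x. (\<Sum>u\<in>UNIV. deg u * x u) = 0 \<Longrightarrow> m * (\<Sum>u\<in>UNIV. deg u * (x u)\<^sup>2) \<le> energy x"
  shows "m / 2 * min (vol S) (vol (- S)) \<le> cut S"
proof -
  define a b where "a = vol S" and "b = vol (- S)"
  have ab: "0 \<le> a" "0 \<le> b" by (simp_all add: a_def b_def vol_nonneg)
  show ?thesis
  proof (cases "a + b = 0")
    case True
    then have "a = 0" "b = 0" using ab by auto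
    then show ?thesis by (simp add: a_def b_def cut_nonneg)
  next
    case False
    then have pos: "0 < a + b" using ab by simp
    define x where "x u = (if u \<in> S then b else - a)" for u
    have split: "(\<Sum>u\<in>UNIV. deg u * h (x u)) = a * h b + b * h (- a)" for h :: "real \<Rightarrow> real"
    proof -
      have "(\<Sum>u\<in>UNIV. deg u * h (x u)) = (\<Sum>u\<in>UNIV. if u \<in> S then deg u * h b else deg u * h (- a))"
        by (intro sum.cong) (auto simp: x_def)
      also have "\<dots> = a * h b + b * h (- a)"
        by (simp add: sum.If_cases a_def b_def vol_def sum_distrib_right Compl_eq)
      finally show ?thesis .
    qed
    have "2 * energy x = (\<Sum>u\<in>UNIV. \<Sum>v\<in>UNIV. W u v * (if u \<in> S \<longleftrightarrow> v \<in> S then 0 else (a + b)\<^sup>2))"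
      unfolding energy_def
      by (simp, intro sum.cong refl) (auto simp: x_def power2_eq_square algebra_simps)
    then have "energy x = (a + b)\<^sup>2 * cut S" by (simp add: cut_eq_double_sum)
    moreover have "m * (\<Sum>u\<in>UNIV. deg u * (x u)\<^sup>2) \<le> energy x"
      using split[of "\<lambda>t. t"] by (intro gap) simp
    ultimately have "m * (a * b\<^sup>2 + b * a\<^sup>2) \<le> (a + b)\<^sup>2 * cut S"
      using split[of "\<lambda>t. t\<^sup>2"] by simp
    then have "(a + b) * (m * (a * b)) \<le> (a + b) * ((a + b) * cut S)"
      by (simp add: power2_eq_square algebra_simps)
    then have "m * (a * b) \<le> (a + b) * cut S"
      using pos by simp
    moreover have "min a b * (a + b) \<le> 2 * (a * b)"
      using ab mult_left_mono[of a b a] mult_left_mono[of b a b]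
      by (auto simp: min_def algebra_simps)
    then have "m / 2 * (min a b * (a + b)) \<le> m / 2 * (2 * (a * b))"
      using assms(1) by (intro mult_left_mono) auto
    ultimately have "(a + b) * (m / 2 * min a b) \<le> (a + b) * cut S"
      by (simp add: algebra_simps)
    then show ?thesis using pos by (simp add: a_def b_def)
  qed
qed

text \<open>For a function supported on two nonadjacent vertices only loops can contribute to the adjacency
  form, and they contribute nonnegatively, so that its Rayleigh quotient is at most 1. The values \<open>deg v\<close> and \<open>- deg u\<close> make the weighted
  mean vanish.\<close>

lemma gap_le_1_if_nonadjacent:
  assumes deg: "\<And>u. 0 < deg u" and uv: "u \<noteq> v" "W u v = 0"
    and gap: "\<And>x. (\<Sum>u\<in>UNIV. deg u * x u) = 0 \<Longrightarrow> m * (\<Sum>u\<in>UNIV. deg u * (x u)\<^sup>2) \<le> energy x"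
  shows "m \<le> 1"
proof -
  define x where "x w = (if w = u then deg v else if w = v then - deg u else 0)" for w
  have "(\<Sum>w\<in>UNIV. deg w * x w) = (\<Sum>w\<in>{u, v}. deg w * x w)"
    by (rule sum.mono_neutral_right) (auto simp: x_def)
  also have "\<dots> = 0" using uv by (simp add: x_def)
  finally have "m * (\<Sum>u\<in>UNIV. deg u * (x u)\<^sup>2) \<le> energy x" by (rule gap)
  also have "\<dots> \<le> (\<Sum>u\<in>UNIV. deg u * (x u)\<^sup>2)"
  proof -
    have "0 \<le> W w w' * (x w * x w')" for w w'
      using uv deg W_nonneg W_sym[of v u] by (auto simp: x_def)
    then show ?thesis
      unfolding energy_eq_adjacency_form by (simp add: sum_nonneg)
  qed
  finally have "m * (\<Sum>u\<in>UNIV. deg u * (x u)\<^sup>2) \<le> 1 * (\<Sum>u\<in>UNIV. deg u * (x u)\<^sup>2)" by simp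
  moreover have "0 < (\<Sum>u\<in>UNIV. deg u * (x u)\<^sup>2)"
    by (rule sum_pos2[of _ u]) (use deg[of u] deg[of v] in \<open>auto simp: x_def deg_nonneg\<close>)
  ultimately show ?thesis by (simp only: mult_le_cancel_right_pos)
qed

end

section \<open>The weighted graph of a hypergraph\<close>

text \<open>Double counting: a hyperedge \<open>e\<close> is counted once for each pair in \<open>(e \<inter> X) \<times> (e \<inter> Y)\<close>. With
  \<open>X = {u}\<close> this identifies the degrees, and with \<open>Y = - X\<close> the boundary weights.\<close>

lemma sum_adjacent_pairs:
  fixes H :: "'v::finite hypergraph" and f :: "'v set \<Rightarrow> real"
  assumes "finite X" "finite Y"
  shows "(\<Sum>u\<in>X. \<Sum>v\<in>Y. \<Sum>e\<in>{e \<in> hyperedges H. {u, v} \<subseteq> e}. f e) =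
    (\<Sum>e\<in>hyperedges H. f e * real (card (e \<inter> X)) * real (card (e \<inter> Y)))"
proof -
  have card: "(\<Sum>u\<in>Z. if u \<in> e then 1 else 0) = real (card (e \<inter> Z))" if "finite Z" for Z and e :: "'v set"
    using that by (simp add: sum.If_cases Int_commute)
  have "(\<Sum>e\<in>{e \<in> hyperedges H. {u, v} \<subseteq> e}. f e) =
    (\<Sum>e\<in>hyperedges H. f e * ((if u \<in> e then 1 else 0) * (if v \<in> e then 1 else 0)))" for u v
    by (subst sum.inter_filter) (auto intro!: sum.cong)
  then have "(\<Sum>u\<in>X. \<Sum>v\<in>Y. \<Sum>e\<in>{e \<in> hyperedges H. {u, v} \<subseteq> e}. f e) =
    (\<Sum>u\<in>X. \<Sum>e\<in>hyperedges H. \<Sum>v\<in>Y. f e * ((if u \<in> e then 1 else 0) * (if v \<in> e then 1 else 0)))"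
    by (simp only: sum.swap[of _ _ Y])
  also have "\<dots> = (\<Sum>e\<in>hyperedges H. \<Sum>u\<in>X. \<Sum>v\<in>Y. f e * ((if u \<in> e then 1 else 0) * (if v \<in> e then 1 else 0)))"
    by (rule sum.swap)
  also have "\<dots> = (\<Sum>e\<in>hyperedges H. f e * ((\<Sum>u\<in>X. if u \<in> e then 1 else 0) * (\<Sum>v\<in>Y. if v \<in> e then 1 else 0)))"
    unfolding sum_product by (simp only: sum_distrib_left)
  finally show ?thesis by (simp only: card assms mult.assoc)
qed

definition adjacency_weight :: "'v::finite hypergraph \<Rightarrow> 'v \<Rightarrow> 'v \<Rightarrow> real" where
  "adjacency_weight H u v = adjacency_matrix H $ u $ v"

lemma weighted_graph_adjacency:
  assumes "is_hypergraph H"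
  shows "weighted_graph (adjacency_weight H)"
proof
  fix u v
  show "adjacency_weight H u v = adjacency_weight H v u"
    by (simp add: adjacency_weight_def adjacency_matrix_def insert_commute)
  show "0 \<le> adjacency_weight H u v"
    using assms
    by (fastforce simp: adjacency_weight_def adjacency_matrix_def is_hypergraph_def intro!: sum_nonneg divide_nonneg_nonneg)
qed

text \<open>A hyperedge through \<open>u\<close> has \<open>card e - 1\<close> further vertices, which cancels the denominator of its
  weight in the adjacency matrix.\<close>

lemma adjacency_row_sum:
  fixes H :: "'v::finite hypergraph"
  assumes "is_hypergraph H"
  shows "(\<Sum>v\<in>UNIV. adjacency_weight H u v) = degree_of H u"
proof -
  let ?f = "\<lambda>e. weight H e / (real (card e) - 1)"
  have "(\<Sum>v\<in>UNIV. adjacency_weight H u v) = (\<Sum>v\<in>-{u}. adjacency_weight H u v)"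
    by (rule sum.mono_neutral_right) (auto simp: adjacency_weight_def adjacency_matrix_def)
  also have "\<dots> = (\<Sum>w\<in>{u}. \<Sum>v\<in>-{u}. \<Sum>e\<in>{e \<in> hyperedges H. {w, v} \<subseteq> e}. ?f e)"
    by (auto simp: adjacency_weight_def adjacency_matrix_def intro!: sum.cong)
  also have "\<dots> = (\<Sum>e\<in>hyperedges H. ?f e * real (card (e \<inter> {u})) * real (card (e \<inter> - {u})))"
    by (rule sum_adjacent_pairs) (rule finite)+
  also have "\<dots> = (\<Sum>e\<in>hyperedges H. if u \<in> e then weight H e else 0)"
  proof (intro sum.cong refl)
    fix e assume "e \<in> hyperedges H"
    then have e: "2 \<le> card e" using assms by (simp add: is_hypergraph_def)
    show "?f e * real (card (e \<inter> {u})) * real (card (e \<inter> - {u})) = (if u \<in> e then weight H e else 0)"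
    proof (cases "u \<in> e")
      case True
      then have "e \<inter> {u} = {u}" "e \<inter> - {u} = e - {u}" by auto
      then show ?thesis using True e by (simp add: of_nat_diff card_Diff_singleton)
    qed simp
  qed
  also have "\<dots> = degree_of H u"
    by (simp add: degree_of_def sum.inter_filter)
  finally show ?thesis .
qed

lemma adjacency_cut:
  fixes H :: "'v::finite hypergraph"
  shows "(\<Sum>u\<in>S. \<Sum>v\<in>-S. adjacency_weight H u v) =
    (\<Sum>e\<in>edge_boundary H S.
        weight H e / (real (card e) - 1) * real (card (e \<inter> S)) * real (card (e \<inter> (- S))))"
proof -
  have "(\<Sum>u\<in>S. \<Sum>v\<in>-S. adjacency_weight H u v) =
    (\<Sum>u\<in>S. \<Sum>v\<in>-S. \<Sum>e\<in>{e \<in> hyperedges H. {u, v} \<subseteq> e}. weight H e / (real (card e) - 1))"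
    by (auto simp: adjacency_weight_def adjacency_matrix_def intro!: sum.cong)
  also have "\<dots> = (\<Sum>e\<in>hyperedges H.
        weight H e / (real (card e) - 1) * real (card (e \<inter> S)) * real (card (e \<inter> (- S))))"
    by (rule sum_adjacent_pairs) auto
  also have "\<dots> = (\<Sum>e\<in>edge_boundary H S.
        weight H e / (real (card e) - 1) * real (card (e \<inter> S)) * real (card (e \<inter> (- S))))"
    by (rule sum.mono_neutral_right) (auto simp: edge_boundary_def)
  finally show ?thesis .
qed

lemma nonadjacent_vertices:
  assumes "\<not> covering H"
  obtains u v where "u \<noteq> v" "adjacency_weight H u v = 0"
proof -
  obtain u v where uv: "u \<noteq> v" "\<not> (\<exists>e\<in>hyperedges H. {u, v} \<subseteq> e)"
    using assms by (auto simp: covering_def)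
  have none: "{e \<in> hyperedges H. {u, v} \<subseteq> e} = {}" using uv(2) by blast
  have "adjacency_weight H u v = 0"
    using uv(1) unfolding adjacency_weight_def adjacency_matrix_def by (simp add: none del: insert_subset)
  with uv(1) show ?thesis using that by blast
qed

lemma normalized_laplacian_component:
  "normalized_laplacian H $ u $ v =
     ((if u = v then degree_of H u else 0) - adjacency_weight H u v) /
     (sqrt (degree_of H u) * sqrt (degree_of H v))"
proof -
  have diag: "(diagonal_matrix d ** A) $ i $ j = d i * A $ i $ j"
    "(A ** diagonal_matrix d) $ i $ j = A $ i $ j * d j" for d :: "'a \<Rightarrow> real" and A i j
    by (simp_all add: diagonal_matrix_def matrix_matrix_mult_def
        if_distrib[of "\<lambda>x. x * _"] if_distrib[of "\<lambda>x. _ * x"] cong: if_cong)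
  show ?thesis
    unfolding normalized_laplacian_def diag laplacian_def
    by (simp add: diagonal_matrix_def adjacency_weight_def)
qed

text \<open>The substitution \<open>x = D\<^sup>1\<^sup>/\<^sup>2 g\<close>, under which the Euclidean inner product becomes the
  degree-weighted one and the normalized Laplacian becomes the random-walk Laplacian.\<close>

definition degree_scaled :: "'v::finite hypergraph \<Rightarrow> ('v \<Rightarrow> real) \<Rightarrow> real ^ 'v" where
  "degree_scaled H g = (\<chi> u. sqrt (degree_of H u) * g u)"

lemma inner_degree_scaled:
  assumes "is_hypergraph H"
  shows "degree_scaled H g \<bullet> degree_scaled H h = (\<Sum>u\<in>UNIV. degree_of H u * (g u * h u))"
proof -
  have "sqrt (degree_of H u) * g u * (sqrt (degree_of H u) * h u) = degree_of H u * (g u * h u)" for u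
  proof -
    have "sqrt (degree_of H u) * sqrt (degree_of H u) = degree_of H u"
      using assms by (simp add: is_hypergraph_def less_imp_le)
    then show ?thesis by (metis mult.assoc mult.left_commute)
  qed
  then show ?thesis
    unfolding degree_scaled_def inner_vec_def by (simp only: vec_lambda_beta inner_real_def)
qed

lemma normalized_laplacian_degree_scaled:
  assumes H: "is_hypergraph H"
  shows "normalized_laplacian H *v degree_scaled H g =
    degree_scaled H (\<lambda>u. (\<Sum>v\<in>UNIV. adjacency_weight H u v * (g u - g v)) / degree_of H u)"
proof -
  have pos: "0 < degree_of H u" for u using H by (simp add: is_hypergraph_def)
  have "(\<Sum>v\<in>UNIV. normalized_laplacian H $ u $ v * (sqrt (degree_of H v) * g v)) =
    sqrt (degree_of H u) * ((\<Sum>v\<in>UNIV. adjacency_weight H u v * (g u - g v)) / degree_of H u)" for u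
  proof -
    have "(\<Sum>v\<in>UNIV. adjacency_weight H u v * (g u - g v)) =
      degree_of H u * g u - (\<Sum>v\<in>UNIV. adjacency_weight H u v * g v)"
      unfolding adjacency_row_sum[OF H, symmetric]
      by (simp add: algebra_simps sum_subtractf sum_distrib_left)
    also have "\<dots> = (\<Sum>v\<in>UNIV. ((if u = v then degree_of H u else 0) - adjacency_weight H u v) * g v)"
      by (simp add: left_diff_distrib sum_subtractf if_distrib[of "\<lambda>x. x * _"] cong: if_cong)
    finally have row: "(\<Sum>v\<in>UNIV. ((if u = v then degree_of H u else 0) - adjacency_weight H u v) * g v)
      = (\<Sum>v\<in>UNIV. adjacency_weight H u v * (g u - g v))" ..
    have "normalized_laplacian H $ u $ v * (sqrt (degree_of H v) * g v) =
      ((if u = v then degree_of H u else 0) - adjacency_weight H u v) * g v / sqrt (degree_of H u)" for v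
      using pos[of v] by (simp add: normalized_laplacian_component)
    then have "(\<Sum>v\<in>UNIV. normalized_laplacian H $ u $ v * (sqrt (degree_of H v) * g v)) =
      (\<Sum>v\<in>UNIV. adjacency_weight H u v * (g u - g v)) / sqrt (degree_of H u)"
      by (simp only: sum_divide_distrib[symmetric] row)
    also have "1 / sqrt (degree_of H u) = sqrt (degree_of H u) / degree_of H u"
      using pos[of u] by (simp add: real_div_sqrt field_simps)
    then have "(\<Sum>v\<in>UNIV. adjacency_weight H u v * (g u - g v)) / sqrt (degree_of H u) =
      sqrt (degree_of H u) * ((\<Sum>v\<in>UNIV. adjacency_weight H u v * (g u - g v)) / degree_of H u)"
      by (metis (no_types, lifting) mult.commute mult.right_neutral times_divide_eq_right)
    finally show ?thesis .
  qed
  then show ?thesis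
    by (simp add: vec_eq_iff matrix_vector_mult_def degree_scaled_def)
qed

lemma degree_scaled_surj:
  assumes "is_hypergraph H"
  obtains g where "x = degree_scaled H g"
proof
  have "sqrt (degree_of H u) \<noteq> 0" for u using assms by (metis is_hypergraph_def less_irrefl real_sqrt_eq_zero_cancel_iff)
  then show "x = degree_scaled H (\<lambda>u. x $ u / sqrt (degree_of H u))"
    by (simp add: degree_scaled_def vec_eq_iff)
qed

text \<open>The variational description of the second eigenvalue in terms of functions on the vertices. The
  kernel vector of the normalized Laplacian is the image of the constant function 1, so
  orthogonality to it means weighted mean 0.\<close>

lemma spectral_gap_of_hypergraph:
  fixes H :: "'v::finite hypergraph"
  assumes H: "is_hypergraph H" and card: "2 \<le> CARD('v)"
  obtains g where "g \<noteq> (\<lambda>_. 0)" "(\<Sum>u\<in>UNIV. degree_of H u * g u) = 0"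
    "\<And>u. (\<Sum>v\<in>UNIV. adjacency_weight H u v * (g u - g v)) = \<nu> H 2 * (degree_of H u * g u)"
    "\<And>x. (\<Sum>u\<in>UNIV. degree_of H u * x u) = 0 \<Longrightarrow>
      \<nu> H 2 * (\<Sum>u\<in>UNIV. degree_of H u * (x u)\<^sup>2) \<le> weighted_graph.energy (adjacency_weight H) x"
    "0 \<le> \<nu> H 2"
proof -
  interpret weighted_graph "adjacency_weight H"
    using H by (rule weighted_graph_adjacency)
  have pos: "0 < degree_of H u" for u using H by (simp add: is_hypergraph_def)
  let ?M = "normalized_laplacian H"
  let ?z = "degree_scaled H (\<lambda>_. 1)"
  have form: "degree_scaled H x \<bullet> (?M *v degree_scaled H x) = energy x" for x
  proof -
    have "degree_of H u * (x u * (y / degree_of H u)) = x u * y" for u y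
      using pos[of u] by simp
    then show ?thesis
      by (simp only: normalized_laplacian_degree_scaled[OF H] inner_degree_scaled[OF H]
          energy_eq_laplacian_form)
  qed
  have sym: "transpose ?M = ?M"
    by (auto simp: vec_eq_iff transpose_def normalized_laplacian_component mult.commute W_sym)
  have psd: "0 \<le> x \<bullet> (?M *v x)" for x
    using degree_scaled_surj[OF H, of x] form energy_nonneg by metis
  have "?z $ u \<noteq> 0" for u
    using pos[of u] by (simp add: degree_scaled_def)
  then have z: "?z \<noteq> 0" by (metis zero_index)
  have Mz: "?M *v ?z = 0"
    unfolding normalized_laplacian_degree_scaled[OF H] by (simp add: degree_scaled_def vec_eq_iff)
  have nu: "sorted_eigenvalues ?M ! 1 = \<nu> H 2" by (simp add: nth_eigenvalue_def)
  obtain f where f: "f \<noteq> 0" "?z \<bullet> f = 0" "?M *v f = \<nu> H 2 *\<^sub>R f"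
    and gap: "\<And>x. ?z \<bullet> x = 0 \<Longrightarrow> \<nu> H 2 * (x \<bullet> x) \<le> x \<bullet> (?M *v x)"
    using second_eigenvalue_variational[OF sym psd z Mz card] unfolding nu by blast
  obtain g where g: "f = degree_scaled H g" by (rule degree_scaled_surj[OF H])
  show ?thesis
  proof
    show "g \<noteq> (\<lambda>_. 0)" using f(1) by (auto simp: g degree_scaled_def vec_eq_iff)
    show "(\<Sum>u\<in>UNIV. degree_of H u * g u) = 0"
      using f(2) by (simp add: g inner_degree_scaled[OF H])
    show "(\<Sum>v\<in>UNIV. adjacency_weight H u v * (g u - g v)) = \<nu> H 2 * (degree_of H u * g u)" for u
    proof -
      have "(?M *v f) $ u = (\<nu> H 2 *\<^sub>R f) $ u" using f(3) by simp
      then show ?thesis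
        unfolding g normalized_laplacian_degree_scaled[OF H]
        using pos[of u] by (simp add: degree_scaled_def field_simps)
    qed
    show "\<nu> H 2 * (\<Sum>u\<in>UNIV. degree_of H u * (x u)\<^sup>2) \<le> energy x"
      if "(\<Sum>u\<in>UNIV. degree_of H u * x u) = 0" for x
      using gap[of "degree_scaled H x"] that
      by (simp add: inner_degree_scaled[OF H] form power2_eq_square)
    have "0 \<le> \<nu> H 2 * (f \<bullet> f)" using psd[of f] f(3) by simp
    moreover have "0 < f \<bullet> f" using f(1) by simp
    ultimately show "0 \<le> \<nu> H 2" by (simp only: zero_le_mult_iff) linarith
  qed
qed

theorem theorem4p3:
  fixes H :: "'v::finite hypergraph"
  assumes "is_hypergraph H" and "\<not> covering H"
  shows "\<nu> H 2 / 2 \<le> diffusion_conductance H \<and>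
         diffusion_conductance H \<le> sqrt ((2 - \<nu> H 2) * \<nu> H 2)"
proof -
  note H = assms(1)
  interpret weighted_graph "adjacency_weight H"
    using H by (rule weighted_graph_adjacency)
  have deg: "deg = degree_of H"
    by (simp add: fun_eq_iff deg_def adjacency_row_sum[OF H])
  have pos: "0 < deg u" for u using H by (simp add: deg is_hypergraph_def)
  obtain u v where uv: "u \<noteq> v" "adjacency_weight H u v = 0"
    using assms(2) by (rule nonadjacent_vertices)
  then have "card {u, v} = 2" by simp
  then have card: "2 \<le> CARD('v)"
    by (metis card_mono finite subset_UNIV)
  obtain g where g: "g \<noteq> (\<lambda>_. 0)" "(\<Sum>u\<in>UNIV. deg u * g u) = 0"
    "\<And>u. (\<Sum>v\<in>UNIV. adjacency_weight H u v * (g u - g v)) = \<nu> H 2 * (deg u * g u)"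
    and gap: "\<And>x. (\<Sum>u\<in>UNIV. deg u * x u) = 0 \<Longrightarrow>
      \<nu> H 2 * (\<Sum>u\<in>UNIV. deg u * (x u)\<^sup>2) \<le> energy x"
    and nu0: "0 \<le> \<nu> H 2"
    using spectral_gap_of_hypergraph[OF H card] unfolding deg by blast
  have nu1: "\<nu> H 2 \<le> 1"
    using pos uv gap by (rule gap_le_1_if_nonadjacent)
  let ?C = "{S :: 'v set. {} \<subset> S \<and> S \<subset> UNIV}"
  have cond: "diffusion_conductance_set H S = cut S / min (vol S) (vol (- S))" for S
    by (simp add: diffusion_conductance_set_def cut_def adjacency_cut vol_def volume_def deg)
  have volpos: "0 < min (vol S) (vol (- S))" if "S \<in> ?C" for S
    using that pos by (auto simp: vol_def intro!: sum_pos)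
  have "{u} \<in> ?C" using uv(1) by auto
  then have ne: "?C \<noteq> {}" by blast
  have min_le: "diffusion_conductance H \<le> diffusion_conductance_set H S" if "S \<in> ?C" for S
    unfolding diffusion_conductance_def using that by (intro Min_le) auto
  have le_min: "c \<le> diffusion_conductance H"
    if "\<And>S. S \<in> ?C \<Longrightarrow> c \<le> diffusion_conductance_set H S" for c
    unfolding diffusion_conductance_def using that ne by (intro Min.boundedI) auto
  have "\<nu> H 2 / 2 \<le> diffusion_conductance H"
  proof (rule le_min)
    fix S assume "S \<in> ?C"
    then show "\<nu> H 2 / 2 \<le> diffusion_conductance_set H S"
      using cheeger_lower_bound[OF nu0 gap, of S] volpos[of S]
      by (simp add: cond pos_le_divide_eq)
  qed
  moreover from this have phi0: "0 \<le> diffusion_conductance H" using nu0 by simp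
  have "(diffusion_conductance H)\<^sup>2 \<le> (2 - \<nu> H 2) * \<nu> H 2"
  proof (rule cheeger_upper_bound[OF pos g nu1 phi0])
    fix S :: "'v set" assume "{} \<subset> S" "S \<subset> UNIV"
    then have S: "S \<in> ?C" by blast
    show "diffusion_conductance H * min (vol S) (vol (- S)) \<le> cut S"
      using min_le[OF S] volpos[OF S] by (simp only: cond pos_le_divide_eq)
  qed
  then have "diffusion_conductance H \<le> sqrt ((2 - \<nu> H 2) * \<nu> H 2)"
    by (rule real_le_rsqrt)
  ultimately show ?thesis by blast
qed

end
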